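(* Let $t\ge 2$ and let $a,b,c,d\ge 0$ be integers with $a\ge d$ and $b\ge c$. If $b>c$, or if $a\ge 1$ and $b\ge 1$, then ${\rm forb}(m,t\cdot F_{a,b,c,d})$ is $\Theta(m^{a+b})$ as $m\to\infty$.
   Context: A matrix is simple if it is a (0,1)-matrix with no repeated columns. For (0,1)-matrices $F$ and $A$, $F\prec A$ means some row and column permutation of $F$ is a submatrix of $A$. ${\rm forb}(m,F)$ is the maximum number of columns of an $m$-rowed simple matrix $A$ with $F\not\prec A$ ($F$ need not be simple). $t\cdot M$ denotes the concatenation of $t$ copies of the matrix $M$. $F_{e,f,g,h}$ denotes the $(e+f+g+h)\times 2$ (0,1)-matrix with $e$ rows $[1\,1]$, $f$ rows $[1\,0]$, $g$ rows $[0\,1]$ and $h$ rows $[0\,0]$. *)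

theory Defs
  imports "Jordan_Normal_Form.DL_Submatrix" "HOL-Combinatorics.Permutations"
    "HOL-Library.Landau_Symbols"
begin

definition zero_one_mat :: "nat mat \<Rightarrow> bool" where
  "zero_one_mat A \<longleftrightarrow> elements_mat A \<subseteq> {0, 1}"

definition simple_mat :: "nat mat \<Rightarrow> bool" where
  "simple_mat A \<longleftrightarrow> zero_one_mat A \<and> distinct (cols A)"

definition config :: "nat mat \<Rightarrow> nat mat \<Rightarrow> bool" (infix "\<prec>" 50) where
  "F \<prec> A \<longleftrightarrow> (\<exists>p q I J. p permutes {..<dim_row F} \<and> q permutes {..<dim_col F} \<and>
     submatrix A I J = mat (dim_row F) (dim_col F) (\<lambda>(i, j). F $$ (p i, q j)))"

text \<open>The set below is finite, as a simple matrix with \<open>m\<close> rows has at most \<open>2 ^ m\<close>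
  columns; it contains \<open>0\<close> whenever \<open>F\<close> has at least one column.\<close>

definition forb :: "nat \<Rightarrow> nat mat \<Rightarrow> nat" where
  "forb m F = Max {n. \<exists>A \<in> carrier_mat m n. simple_mat A \<and> \<not> F \<prec> A}"

definition copies :: "nat \<Rightarrow> nat mat \<Rightarrow> nat mat" where
  "copies t M = mat_of_cols (dim_row M) (concat (replicate t (cols M)))"

definition two_col_mat :: "nat \<Rightarrow> nat \<Rightarrow> nat \<Rightarrow> nat \<Rightarrow> nat mat" where
  "two_col_mat e f g h = mat_of_rows_list 2
     (replicate e [1, 1] @ replicate f [1, 0] @ replicate g [0, 1] @ replicate h [0, 0])"

end

theory Submission
  imports Defs
begin

text \<open>
  Identify the columns of a simple matrix with a family of subsets of \<open>{..<m}\<close>. For the lower bound,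
  two distinct sets of size \<open>a + b\<close> cannot both contain the same \<open>a + b\<close> rows. For the upper bound,
  a prefix in \<open>{..<k}\<close> with at least \<open>t\<close> extensions in the family is called heavy; the heavy prefixes
  of length \<open>k\<close> form a family without the configuration \<open>F\<^bsub>a,b,c,d\<^esub>\<close>, and every member of the family is
  charged to its longest heavy prefix. It remains to bound a family without \<open>F\<^bsub>a,b,c,d\<^esub>\<close> by
  \<open>O(m ^ (a + b - 1))\<close>. Deleting the last row loses only the sets \<open>X\<close> for which \<open>X\<close> and \<open>insert m X\<close>
  both occur; those avoid each configuration obtained by removing one row from \<open>F\<^bsub>a,b,c,d\<^esub>\<close>. Split into
  boundedly many parts, mainly by the size of \<open>X\<close>, they avoid a configuration of smaller order.
\<close>

section \<open>Families of sets and forbidden patterns of two sets\<close>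

text \<open>The ordered pair \<open>(X, Y)\<close> ranges over equal members too; for \<open>b + c > 0\<close> this is immaterial.\<close>

definition avoids :: "nat \<Rightarrow> nat \<Rightarrow> nat \<Rightarrow> nat \<Rightarrow> nat \<Rightarrow> nat set set \<Rightarrow> bool" where
  "avoids a b c d m \<F> \<longleftrightarrow> (\<forall>X\<in>\<F>. \<forall>Y\<in>\<F>. \<not> (a \<le> card (X \<inter> Y) \<and> b \<le> card (X - Y) \<and>
     c \<le> card (Y - X) \<and> d \<le> card ({..<m} - (X \<union> Y))))"

text \<open>One constant \<open>K\<close> has to serve all \<open>m\<close>. The base
  \<open>m + 1\<close> instead of \<open>m\<close> leaves room for the single set over no rows when
  \<open>m = 0\<close>.\<close>

definition poly_bounded :: "nat \<Rightarrow> nat \<Rightarrow> nat \<Rightarrow> nat \<Rightarrow> nat \<Rightarrow> bool" where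
  "poly_bounded a b c d n \<longleftrightarrow>
     (\<exists>K. \<forall>m \<F>. \<F> \<subseteq> Pow {..<m} \<longrightarrow> avoids a b c d m \<F> \<longrightarrow> card \<F> \<le> K * (m + 1) ^ n)"

text \<open>In matrix terms, the columns that occur twice once row \<open>m\<close> is
  deleted.\<close>

definition doubled :: "nat \<Rightarrow> nat set set \<Rightarrow> nat set set" where
  "doubled m \<F> = {X. X \<subseteq> {..<m} \<and> X \<in> \<F> \<and> insert m X \<in> \<F>}"

lemma avoidsD:
  assumes "avoids a b c d m \<F>" "X \<in> \<F>" "Y \<in> \<F>" "a \<le> card (X \<inter> Y)" "b \<le> card (X - Y)"
    "c \<le> card (Y - X)" "d \<le> card ({..<m} - (X \<union> Y))"
  shows False
  using assms unfolding avoids_def by blast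

lemma avoids_mono:
  assumes "avoids a b c d m \<F>" "\<G> \<subseteq> \<F>" "a \<le> a'" "b \<le> b'" "c \<le> c'" "d \<le> d'"
  shows "avoids a' b' c' d' m \<G>"
  using assms unfolding avoids_def by (meson le_trans subsetD)

text \<open>Avoiding a smaller pattern is the stronger condition, so a bound for a large pattern is
  inherited by every pattern below it.\<close>

lemma poly_bounded_mono:
  assumes "poly_bounded a' b' c' d' n" "a \<le> a'" "b \<le> b'" "c \<le> c'" "d \<le> d'"
  shows "poly_bounded a b c d n"
  using assms(1) avoids_mono[OF _ order_refl assms(2-5)] unfolding poly_bounded_def by blast

lemma doubled_subset: "doubled m \<F> \<subseteq> Pow {..<m}"
  by (auto simp: doubled_def)

lemma finite_family: "\<F> \<subseteq> Pow {..<m::nat} \<Longrightarrow> finite \<F>"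
  by (meson finite_Pow_iff finite_lessThan finite_subset)

lemma finite_member: "X \<subseteq> {..<m::nat} \<Longrightarrow> finite X"
  by (meson finite_lessThan finite_subset)

lemma card_subset_Pow: "\<F> \<subseteq> Pow {..<m::nat} \<Longrightarrow> card \<F> \<le> 2 ^ m"
  by (metis card_Pow card_lessThan card_mono finite_Pow_iff finite_lessThan)

section \<open>Deleting the last row: the standard induction\<close>

text \<open>The point \<open>m\<close> can be added to \<open>X\<close>, to \<open>Y\<close>, to
  both or to neither; each choice enlarges exactly one of the four regions, by one point. These are
  the four ways to restore a row removed from the pattern.\<close>

lemma card_insert_outside:
  assumes X: "X \<subseteq> {..<m}" and Y: "Y \<subseteq> {..<m::nat}"
  shows "card (insert m X \<inter> insert m Y) = Suc (card (X \<inter> Y))"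
    "insert m X \<inter> Y = X \<inter> Y" "X \<inter> insert m Y = X \<inter> Y"
    "insert m X - insert m Y = X - Y" "card (insert m X - Y) = Suc (card (X - Y))"
    "X - insert m Y = X - Y"
    "{..<Suc m} - (insert m X \<union> insert m Y) = {..<m} - (X \<union> Y)"
    "{..<Suc m} - (insert m X \<union> Y) = {..<m} - (X \<union> Y)"
    "{..<Suc m} - (X \<union> insert m Y) = {..<m} - (X \<union> Y)"
    "card ({..<Suc m} - (X \<union> Y)) = Suc (card ({..<m} - (X \<union> Y)))"
proof -
  have out: "m \<notin> X" "m \<notin> Y" and fin: "finite X" "finite Y"
    using X Y finite_member by auto
  show "insert m X \<inter> Y = X \<inter> Y" "X \<inter> insert m Y = X \<inter> Y" "insert m X - insert m Y = X - Y"
    "X - insert m Y = X - Y"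
    "{..<Suc m} - (insert m X \<union> insert m Y) = {..<m} - (X \<union> Y)"
    "{..<Suc m} - (insert m X \<union> Y) = {..<m} - (X \<union> Y)"
    "{..<Suc m} - (X \<union> insert m Y) = {..<m} - (X \<union> Y)"
    using out by (auto simp: lessThan_Suc)
  have "insert m X \<inter> insert m Y = insert m (X \<inter> Y)" "insert m X - Y = insert m (X - Y)"
    "{..<Suc m} - (X \<union> Y) = insert m ({..<m} - (X \<union> Y))"
    using out by (auto simp: lessThan_Suc)
  then show "card (insert m X \<inter> insert m Y) = Suc (card (X \<inter> Y))"
    "card (insert m X - Y) = Suc (card (X - Y))"
    "card ({..<Suc m} - (X \<union> Y)) = Suc (card ({..<m} - (X \<union> Y)))"
    using out fin by simp_all
qed

lemma doubledD:
  assumes "X \<in> doubled m \<F>"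
  shows "X \<in> \<F>" "insert m X \<in> \<F>" "X \<subseteq> {..<m}"
  using assms by (auto simp: doubled_def)

text \<open>Each of two doubled sets may be lifted with or without \<open>m\<close>, independently.
  Here both receive \<open>m\<close>, which supplies the missing row [1 1]; the three lemmas that
  follow use the other choices.\<close>

lemma avoids_doubled_both:
  assumes "avoids (Suc a) b c d (Suc m) \<F>"
  shows "avoids a b c d m (doubled m \<F>)"
  unfolding avoids_def
proof (intro ballI notI, elim conjE)
  fix X Y assume X: "X \<in> doubled m \<F>" and Y: "Y \<in> doubled m \<F>"
    and "a \<le> card (X \<inter> Y)" "b \<le> card (X - Y)" "c \<le> card (Y - X)" "d \<le> card ({..<m} - (X \<union> Y))"
  then show False
    by (intro avoidsD[OF assms doubledD(2)[OF X] doubledD(2)[OF Y]])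
      (simp_all only: card_insert_outside[OF doubledD(3) doubledD(3), OF X Y]
        card_insert_outside[OF doubledD(3) doubledD(3), OF Y X] Suc_le_mono)
qed

lemma avoids_doubled_left:
  assumes "avoids a (Suc b) c d (Suc m) \<F>"
  shows "avoids a b c d m (doubled m \<F>)"
  unfolding avoids_def
proof (intro ballI notI, elim conjE)
  fix X Y assume X: "X \<in> doubled m \<F>" and Y: "Y \<in> doubled m \<F>"
    and "a \<le> card (X \<inter> Y)" "b \<le> card (X - Y)" "c \<le> card (Y - X)" "d \<le> card ({..<m} - (X \<union> Y))"
  then show False
    by (intro avoidsD[OF assms doubledD(2)[OF X] doubledD(1)[OF Y]])
      (simp_all only: card_insert_outside[OF doubledD(3) doubledD(3), OF X Y]
        card_insert_outside[OF doubledD(3) doubledD(3), OF Y X] Suc_le_mono)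
qed

lemma avoids_doubled_right:
  assumes "avoids a b (Suc c) d (Suc m) \<F>"
  shows "avoids a b c d m (doubled m \<F>)"
  unfolding avoids_def
proof (intro ballI notI, elim conjE)
  fix X Y assume X: "X \<in> doubled m \<F>" and Y: "Y \<in> doubled m \<F>"
    and "a \<le> card (X \<inter> Y)" "b \<le> card (X - Y)" "c \<le> card (Y - X)" "d \<le> card ({..<m} - (X \<union> Y))"
  then show False
    by (intro avoidsD[OF assms doubledD(1)[OF X] doubledD(2)[OF Y]])
      (simp_all only: card_insert_outside[OF doubledD(3) doubledD(3), OF X Y]
        card_insert_outside[OF doubledD(3) doubledD(3), OF Y X] Suc_le_mono)
qed

lemma avoids_doubled_none:
  assumes "avoids a b c (Suc d) (Suc m) \<F>"
  shows "avoids a b c d m (doubled m \<F>)"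
  unfolding avoids_def
proof (intro ballI notI, elim conjE)
  fix X Y assume X: "X \<in> doubled m \<F>" and Y: "Y \<in> doubled m \<F>"
    and "a \<le> card (X \<inter> Y)" "b \<le> card (X - Y)" "c \<le> card (Y - X)" "d \<le> card ({..<m} - (X \<union> Y))"
  then show False
    by (intro avoidsD[OF assms doubledD(1)[OF X] doubledD(1)[OF Y]])
      (simp_all only: card_insert_outside[OF doubledD(3) doubledD(3), OF X Y]
        card_insert_outside[OF doubledD(3) doubledD(3), OF Y X] Suc_le_mono)
qed

text \<open>Two members share a trace only if they are \<open>X\<close> and
  \<open>insert m X\<close>, so inclusion-exclusion on the members with and without \<open>m\<close>
  loses just the doubled sets.\<close>

lemma card_le_trace_plus_doubled:
  assumes "\<F> \<subseteq> Pow {..<Suc m}"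
  shows "card \<F> \<le> card ((\<lambda>X. X - {m}) ` \<F>) + card (doubled m \<F>)"
proof -
  define F0 F1 where "F0 = {X \<in> \<F>. m \<notin> X}" and "F1 = {X \<in> \<F>. m \<in> X}"
  define F1' where "F1' = (\<lambda>X. X - {m}) ` F1"
  have fin: "finite F0" "finite F1" "finite F1'"
    using finite_family[OF assms] by (auto simp: F0_def F1_def F1'_def)
  have "inj_on (\<lambda>X. X - {m}) F1"
    by (auto simp: inj_on_def F1_def)
  then have "card F1' = card F1" unfolding F1'_def by (rule card_image)
  have "\<F> = F0 \<union> F1" "F0 \<inter> F1 = {}" by (auto simp: F0_def F1_def)
  then have "card \<F> = card F0 + card F1'"
    using fin \<open>card F1' = card F1\<close> by (simp add: card_Un_disjoint)
  also have "\<dots> = card (F0 \<union> F1') + card (F0 \<inter> F1')"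
    using fin(1,3) by (rule card_Un_Int)
  finally have eq: "card \<F> = card (F0 \<union> F1') + card (F0 \<inter> F1')" .
  have "(\<lambda>X. X - {m}) ` F0 = F0"
    by (force simp: F0_def)
  then have "F0 \<union> F1' = (\<lambda>X. X - {m}) ` \<F>"
    unfolding F1'_def \<open>\<F> = F0 \<union> F1\<close> image_Un by simp
  moreover have "F0 \<inter> F1' \<subseteq> doubled m \<F>"
  proof
    fix X assume X: "X \<in> F0 \<inter> F1'"
    then obtain Y where "Y \<in> \<F>" "m \<in> Y" "X = Y - {m}" by (auto simp: F1'_def F1_def)
    then have "insert m X \<in> \<F>" by (simp add: insert_absorb)
    moreover have "X \<in> \<F>" "m \<notin> X" using X by (auto simp: F0_def)
    moreover have "X \<subseteq> {..<m}" using assms \<open>X \<in> \<F>\<close> \<open>m \<notin> X\<close> by (auto simp: lessThan_Suc)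
    ultimately show "X \<in> doubled m \<F>" by (simp add: doubled_def)
  qed
  then have "card (F0 \<inter> F1') \<le> card (doubled m \<F>)"
    by (intro card_mono finite_family[OF doubled_subset])
  ultimately show ?thesis using eq by simp
qed

lemma avoids_trace:
  assumes "avoids a b c d (Suc m) \<F>" "\<F> \<subseteq> Pow {..<Suc m}"
  shows "avoids a b c d m ((\<lambda>X. X - {m}) ` \<F>)"
  unfolding avoids_def
proof (intro ballI notI, elim conjE imageE)
  fix X' Y' X Y assume XY: "X \<in> \<F>" "Y \<in> \<F>" and eq: "X' = X - {m}" "Y' = Y - {m}"
    and c: "a \<le> card (X' \<inter> Y')" "b \<le> card (X' - Y')" "c \<le> card (Y' - X')"
      "d \<le> card ({..<m} - (X' \<union> Y'))"
  have "finite X" "finite Y" using XY assms(2) finite_member by auto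
  then have "card (X' \<inter> Y') \<le> card (X \<inter> Y)" "card (X' - Y') \<le> card (X - Y)"
    "card (Y' - X') \<le> card (Y - X)" "card ({..<m} - (X' \<union> Y')) \<le> card ({..<Suc m} - (X \<union> Y))"
    unfolding eq by (intro card_mono; auto)+
  then show False using avoidsD[OF assms(1) XY] c by linarith
qed

text \<open>Each new row costs at most \<open>K * (m + 1) ^ n\<close> sets, and summation over the
  rows raises the exponent by one.\<close>

lemma poly_bounded_step:
  assumes "\<And>m \<F>. \<F> \<subseteq> Pow {..<Suc m} \<Longrightarrow> avoids a b c d (Suc m) \<F> \<Longrightarrow>
    card (doubled m \<F>) \<le> K * (m + 1) ^ n"
  shows "poly_bounded a b c d (Suc n)"
proof -
  \<comment> \<open>With \<open>K + 1\<close>, the case \<open>m = 0\<close>, where one set may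
    remain, holds even for \<open>K = 0\<close>.\<close>
  have "card \<F> \<le> (K + 1) * (m + 1) ^ Suc n" if "\<F> \<subseteq> Pow {..<m}" "avoids a b c d m \<F>" for m \<F>
    using that
  proof (induction m arbitrary: \<F>)
    case 0
    then show ?case using card_subset_Pow[of \<F> 0] by simp
  next
    case (Suc m)
    have "card ((\<lambda>X. X - {m}) ` \<F>) \<le> (K + 1) * (m + 1) ^ Suc n"
      using Suc.prems(1) by (intro Suc.IH avoids_trace[OF Suc.prems(2,1)]) (fastforce simp: less_Suc_eq)
    then have "card \<F> \<le> (K + 1) * (m + 1) ^ Suc n + K * (m + 1) ^ n"
      using card_le_trace_plus_doubled[OF Suc.prems(1)] assms[OF Suc.prems] by linarith
    also have "\<dots> \<le> (K + 1) * ((m + 2) * (m + 1) ^ n)"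
      by (simp add: algebra_simps)
    also have "\<dots> \<le> (K + 1) * ((m + 2) * (m + 2) ^ n)"
      by (intro mult_le_mono power_mono) auto
    also have "\<dots> = (K + 1) * (Suc m + 1) ^ Suc n"
      by simp
    finally show ?case .
  qed
  then show ?thesis unfolding poly_bounded_def by blast
qed

lemma card_Diff_balance:
  assumes "finite X" "finite Y"
  shows "card (X - Y) + card Y = card (Y - X) + card X"
proof -
  have "card X = card (X \<inter> Y) + card (X - Y)" "card Y = card (Y \<inter> X) + card (Y - X)"
    using assms by (simp_all add: card_Int_Diff)
  then show ?thesis by (simp add: Int_commute)
qed

section \<open>Patterns with difference rows only\<close>

text \<open>Induction on \<open>k\<close>. The doubled family avoids both patterns with one
  difference row removed, so a copy of the next smaller pattern must have differences of size
  exactly \<open>k + 1\<close> and \<open>k\<close>. Each parity class of sizes excludes this and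
  falls under the induction hypothesis.\<close>

lemma poly_bounded_differences: "poly_bounded 0 (Suc k) k 0 k"
proof (induction k)
  case 0
  have "card \<F> \<le> 1" if "\<F> \<subseteq> Pow {..<m}" "avoids 0 (Suc 0) 0 0 m \<F>" for m \<F>
  proof -
    \<comment> \<open>Both orders of a pair are tested, so inclusion holds in both directions and
      all members coincide.\<close>
    have "X \<subseteq> Y" if XY: "X \<in> \<F>" "Y \<in> \<F>" for X Y
    proof (rule ccontr)
      assume "\<not> X \<subseteq> Y"
      moreover have "finite (X - Y)" using XY(1) \<open>\<F> \<subseteq> _\<close> finite_member by auto
      ultimately have "Suc 0 \<le> card (X - Y)"
        by (metis Diff_eq_empty_iff card_0_eq not_less_eq_eq le0 le_zero_eq)
      then show False using avoidsD[OF \<open>avoids _ _ _ _ _ _\<close> XY] by simp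
    qed
    then show ?thesis
      using finite_family[OF \<open>\<F> \<subseteq> _\<close>] by (auto simp: card_le_Suc0_iff_eq)
  qed
  then show ?case unfolding poly_bounded_def by (intro exI[of _ 1]) simp
next
  case (Suc k)
  then obtain K where K: "\<And>m \<F>. \<F> \<subseteq> Pow {..<m} \<Longrightarrow> avoids 0 (Suc k) k 0 m \<F> \<Longrightarrow> card \<F> \<le> K * (m + 1) ^ k"
    unfolding poly_bounded_def by blast
  show ?case
  proof (rule poly_bounded_step[where K = "2 * K"])
    fix m \<F> assume F: "\<F> \<subseteq> Pow {..<Suc m}" and av: "avoids 0 (Suc (Suc k)) (Suc k) 0 (Suc m) \<F>"
    let ?C = "doubled m \<F>"
    have av1: "avoids 0 (Suc k) (Suc k) 0 m ?C" by (rule avoids_doubled_left[OF av])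
    have av2: "avoids 0 (Suc (Suc k)) k 0 m ?C" by (rule avoids_doubled_right[OF av])
    have part: "card {X \<in> ?C. even (card X) = e} \<le> K * (m + 1) ^ k" for e
    proof (rule K)
      show "{X \<in> ?C. even (card X) = e} \<subseteq> Pow {..<m}" using doubled_subset by blast
      show "avoids 0 (Suc k) k 0 m {X \<in> ?C. even (card X) = e}"
        unfolding avoids_def
      proof (intro ballI notI, elim conjE CollectE)
        fix X Y assume X: "X \<in> ?C" and Y: "Y \<in> ?C" and e: "even (card X) = e" "even (card Y) = e"
          and c: "Suc k \<le> card (X - Y)" "k \<le> card (Y - X)"
        have "finite X" "finite Y" using X Y doubled_subset finite_member by blast+
        then have bal: "card (X - Y) + card Y = card (Y - X) + card X" by (rule card_Diff_balance)
        have "card (Y - X) < Suc k" using avoidsD[OF av1 X Y] c by fastforce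
        moreover have "card (X - Y) < Suc (Suc k)" using avoidsD[OF av2 X Y] c by fastforce
        \<comment> \<open>A pair violating the claim has sizes that differ by exactly one, against the parity split.\<close>
        ultimately have "card (X - Y) = Suc k" "card (Y - X) = k" using c by auto
        then have "card X = Suc (card Y)" using bal by simp
        then show False using e by auto
      qed
    qed
    have "?C = {X \<in> ?C. even (card X) = True} \<union> {X \<in> ?C. even (card X) = False}" by auto
    then have "card ?C \<le> card {X \<in> ?C. even (card X) = True} + card {X \<in> ?C. even (card X) = False}"
      by (metis card_Un_le)
    then show "card ?C \<le> 2 * K * (m + 1) ^ k"
      using part[of True] part[of False] by linarith
  qed
qed

section \<open>Symmetric patterns with one row [1 1] and one row [0 0]\<close>

lemma card_small_subsets: "card {X. X \<subseteq> {..<m::nat} \<and> card X \<le> k} \<le> (k + 1) * (m + 1) ^ k"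
proof -
  have "{X. X \<subseteq> {..<m} \<and> card X \<le> k} = (\<Union>i\<in>{..k}. {X. X \<subseteq> {..<m} \<and> card X = i})" by auto
  also have "card \<dots> \<le> (\<Sum>i\<in>{..k}. card {X. X \<subseteq> {..<m} \<and> card X = i})"
    by (rule card_UN_le) simp
  also have "\<dots> = (\<Sum>i\<in>{..k}. m choose i)" by (simp add: n_subsets)
  also have "\<dots> \<le> (\<Sum>i\<in>{..k}. (m + 1) ^ k)"
  proof (rule sum_mono)
    fix i assume "i \<in> {..k}"
    have "m choose i \<le> m ^ i" by (cases "i \<le> m") (auto simp: binomial_le_pow binomial_eq_0)
    also have "\<dots> \<le> (m + 1) ^ i" by (rule power_mono) auto
    also have "\<dots> \<le> (m + 1) ^ k" using \<open>i \<in> _\<close> by (intro power_increasing) auto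
    finally show "m choose i \<le> (m + 1) ^ k" .
  qed
  finally show ?thesis by simp
qed

lemma card_large_subsets: "card {X. X \<subseteq> {..<m::nat} \<and> m - card X \<le> k} \<le> (k + 1) * (m + 1) ^ k"
proof -
  let ?L = "{X. X \<subseteq> {..<m} \<and> m - card X \<le> k}"
  have "inj_on (\<lambda>X. {..<m} - X) ?L" by (auto simp: inj_on_def)
  moreover have "(\<lambda>X. {..<m} - X) ` ?L \<subseteq> {X. X \<subseteq> {..<m} \<and> card X \<le> k}"
    using finite_member by (auto simp: card_Diff_subset)
  ultimately have "card ?L \<le> card {X. X \<subseteq> {..<m} \<and> card X \<le> k}"
    by (rule card_inj_on_le) simp
  then show ?thesis using card_small_subsets le_trans by blast
qed

text \<open>Outside the \<open>O(m ^ k)\<close> very small or very large sets, a copy of the pattern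
  \<open>0, k + 1, k, 0\<close> completes to one of three patterns that the doubled family avoids.
  If the sets are disjoint, \<open>Y - X = Y\<close> is large; if they cover all rows,
  \<open>Y - X\<close> is the complement of \<open>X\<close> and again large; otherwise rows [1 1]
  and [0 0] are both present.\<close>

lemma poly_bounded_both: "poly_bounded 1 (Suc k) (Suc k) 1 (Suc k)"
proof -
  obtain K where K: "\<And>m \<F>. \<F> \<subseteq> Pow {..<m} \<Longrightarrow> avoids 0 (Suc k) k 0 m \<F> \<Longrightarrow> card \<F> \<le> K * (m + 1) ^ k"
    using poly_bounded_differences unfolding poly_bounded_def by blast
  show ?thesis
  proof (rule poly_bounded_step[where K = "2 * K + 2 * (k + 1)"])
    fix m \<F> assume F: "\<F> \<subseteq> Pow {..<Suc m}" and av: "avoids 1 (Suc k) (Suc k) 1 (Suc m) \<F>"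
    let ?C = "doubled m \<F>"
    have av1: "avoids 0 (Suc k) (Suc k) 1 m ?C" using av by (intro avoids_doubled_both) simp
    have av2: "avoids 1 (Suc k) k 1 m ?C" by (rule avoids_doubled_right[OF av])
    have av3: "avoids 1 (Suc k) (Suc k) 0 m ?C" using av by (intro avoids_doubled_none) simp
    \<comment> \<open>Fixing membership of \<open>0\<close> rules out complementary pairs in \<open>M e\<close>.\<close>
    define S where "S = {X. X \<subseteq> {..<m} \<and> card X \<le> k}"
    define L where "L = {X. X \<subseteq> {..<m} \<and> m - card X \<le> k}"
    define M where "M e = {X \<in> ?C. k < card X \<and> k < m - card X \<and> (0 \<in> X) = e}" for e
    have part: "card (M e) \<le> K * (m + 1) ^ k" for e
    proof (rule K)
      show "M e \<subseteq> Pow {..<m}" using doubled_subset unfolding M_def by blast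
      show "avoids 0 (Suc k) k 0 m (M e)"
        unfolding avoids_def M_def
      proof (intro ballI notI, elim conjE CollectE)
        fix X Y assume X: "X \<in> ?C" and Y: "Y \<in> ?C" and e: "(0 \<in> X) = e" "(0 \<in> Y) = e"
          and s: "k < card X" "k < m - card X" "k < card Y" "k < m - card Y"
          and c: "Suc k \<le> card (X - Y)" "k \<le> card (Y - X)"
        have sub: "X \<subseteq> {..<m}" "Y \<subseteq> {..<m}" using X Y doubledD(3) by blast+
        then have fin: "finite X" "finite Y" using finite_member by blast+
        consider "X \<inter> Y = {}" | "X \<inter> Y \<noteq> {}" "{..<m} - (X \<union> Y) = {}"
          | "X \<inter> Y \<noteq> {}" "{..<m} - (X \<union> Y) \<noteq> {}" by blast
        then show False
        proof cases
          case 1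
          then have "Y - X = Y" by blast
          then have "Suc k \<le> card (Y - X)" using s by simp
          \<comment> \<open>Disjoint sets that agree on \<open>0\<close> both omit it, and
            \<open>k < m - card X\<close> gives \<open>0 < m\<close>.\<close>
          moreover have "0 \<in> {..<m} - (X \<union> Y)" using e s 1 by auto
          then have "1 \<le> card ({..<m} - (X \<union> Y))"
            by (metis One_nat_def Suc_leI card_gt_0_iff empty_iff finite_Diff finite_lessThan)
          ultimately show False using avoidsD[OF av1 X Y] c by simp
        next
          case 2
          then have "Y - X = {..<m} - X" using sub by blast
          then have "Suc k \<le> card (Y - X)" using s sub fin by (simp add: card_Diff_subset)
          moreover have "1 \<le> card (X \<inter> Y)" using 2 fin by (simp add: Suc_le_eq card_gt_0_iff)
          ultimately show False using avoidsD[OF av3 X Y] c by simp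
        next
          case 3
          then have "1 \<le> card (X \<inter> Y)" "1 \<le> card ({..<m} - (X \<union> Y))"
            using fin by (simp_all add: Suc_le_eq card_gt_0_iff)
          then show False using avoidsD[OF av2 X Y] c by simp
        qed
      qed
    qed
    have "?C \<subseteq> (M True \<union> M False) \<union> (S \<union> L)"
      using doubledD(3) by (auto simp: M_def S_def L_def)
    moreover have "finite ((M True \<union> M False) \<union> (S \<union> L))"
      using doubled_subset by (intro finite_family[of _ m]) (auto simp: M_def S_def L_def doubled_def)
    ultimately have "card ?C \<le> card ((M True \<union> M False) \<union> (S \<union> L))" by (rule card_mono[rotated])
    also have "\<dots> \<le> (card (M True) + card (M False)) + (card S + card L)"
      by (meson add_mono card_Un_le le_trans)
    also have "\<dots> \<le> (K * (m + 1) ^ k + K * (m + 1) ^ k) + ((k + 1) * (m + 1) ^ k + (k + 1) * (m + 1) ^ k)"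
      unfolding S_def L_def
      by (intro add_mono part card_small_subsets card_large_subsets)
    also have "\<dots> = (2 * K + 2 * (k + 1)) * (m + 1) ^ k" by (simp only: algebra_simps)
    finally show "card ?C \<le> (2 * K + 2 * (k + 1)) * (m + 1) ^ k" .
  qed
qed

section \<open>Symmetric patterns in general, by induction on the number of rows [1 1]\<close>

text \<open>Inclusion-exclusion. It shows that a pair has as many rows [1 1] as rows [0 0] exactly
  when the two sizes sum to \<open>m\<close>.\<close>

lemma card_complement_Un:
  assumes "X \<subseteq> {..<m}" "Y \<subseteq> {..<m::nat}"
  shows "card ({..<m} - (X \<union> Y)) + (card X + card Y) = m + card (X \<inter> Y)"
proof -
  have fin: "finite X" "finite Y" using assms finite_member by blast+
  have "card (X \<union> Y) \<le> m" using assms card_mono[of "{..<m}" "X \<union> Y"] by simp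
  moreover have "card ({..<m} - (X \<union> Y)) = m - card (X \<union> Y)"
    using assms fin by (simp add: card_Diff_subset)
  ultimately show ?thesis using card_Un_Int[OF fin] by linarith
qed

text \<open>The doubled family avoids the pattern \<open>a, b, b, a\<close> enlarged by a row [1 1]
  or by a row [0 0]. A remaining copy of \<open>a, b, b, a\<close> therefore has exactly
  \<open>a\<close> rows of each of these kinds, so its set sizes sum to \<open>m\<close>. It
  suffices to split into four parts without such pairs, apart from boundedly many rows.\<close>

lemma poly_bounded_Suc_both:
  assumes "poly_bounded a b b a n"
  shows "poly_bounded (Suc a) b b (Suc a) (Suc n)"
proof -
  obtain K where K: "\<And>m \<F>. \<F> \<subseteq> Pow {..<m} \<Longrightarrow> avoids a b b a m \<F> \<Longrightarrow> card \<F> \<le> K * (m + 1) ^ n"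
    using assms unfolding poly_bounded_def by blast
  \<comment> \<open>For larger \<open>m\<close>, the size \<open>m / 2\<close> of a middle set
    exceeds both \<open>a + 2 * b\<close>, as needed for \<open>near\<close>, and
    \<open>3 * a\<close>, as needed for \<open>far\<close>. For \<open>m\<close> up to
    \<open>N\<close> the trivial bound \<open>2 ^ N\<close> is enough.\<close>
  define N where "N = 6 * a + 4 * b"
  show ?thesis
  proof (rule poly_bounded_step[where K = "4 * K + 2 ^ N"])
    fix m \<F> assume F: "\<F> \<subseteq> Pow {..<Suc m}" and av: "avoids (Suc a) b b (Suc a) (Suc m) \<F>"
    let ?C = "doubled m \<F>"
    have av1: "avoids a b b (Suc a) m ?C" by (rule avoids_doubled_both[OF av])
    have av2: "avoids (Suc a) b b a m ?C" by (rule avoids_doubled_none[OF av])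
    have part: "card D \<le> K * (m + 1) ^ n"
      if D: "D \<subseteq> ?C" and ex: "\<And>X Y. X \<in> D \<Longrightarrow> Y \<in> D \<Longrightarrow> card X + card Y = m \<Longrightarrow> card (X \<inter> Y) \<noteq> a" for D
    proof (rule K)
      show "D \<subseteq> Pow {..<m}" using D doubled_subset by blast
      show "avoids a b b a m D"
        unfolding avoids_def
      proof (intro ballI notI, elim conjE)
        fix X Y assume X: "X \<in> D" and Y: "Y \<in> D"
          and c: "a \<le> card (X \<inter> Y)" "b \<le> card (X - Y)" "b \<le> card (Y - X)" "a \<le> card ({..<m} - (X \<union> Y))"
        have XC: "X \<in> ?C" and YC: "Y \<in> ?C" using X Y D by blast+
        have "card (X \<inter> Y) = a" using avoidsD[OF av2 XC YC] c by fastforce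
        moreover have "card ({..<m} - (X \<union> Y)) = a" using avoidsD[OF av1 XC YC] c by fastforce
        ultimately have "card X + card Y = m"
          using card_complement_Un[OF doubledD(3)[OF XC] doubledD(3)[OF YC]] by linarith
        then show False using ex[OF X Y] \<open>card (X \<inter> Y) = a\<close> by blast
      qed
    qed
    \<comment> \<open>Bad pairs satisfy \<open>card X + card Y = m\<close>, so they live in the middle layer. There any two
      sets are either close to each other or nearly disjoint, which gives at most two clusters.\<close>
    define L where "L = {X \<in> ?C. 2 * card X < m}"
    define U where "U = {X \<in> ?C. 2 * card X > m}"
    define M where "M = {X \<in> ?C. 2 * card X = m}"
    have L: "card L \<le> K * (m + 1) ^ n" and U: "card U \<le> K * (m + 1) ^ n"
      by (rule part; force simp: L_def U_def)+
    have M: "card M \<le> (2 * K + 2 ^ N) * (m + 1) ^ n"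
    proof (cases "m \<le> N \<or> M = {}")
      case True
      have "M \<subseteq> Pow {..<m}" unfolding M_def using doubled_subset by blast
      then have "card M \<le> 2 ^ m" by (rule card_subset_Pow)
      moreover have "(2::nat) ^ m \<le> 2 ^ N" if "m \<le> N" using that by (intro power_increasing) auto
      ultimately have "card M \<le> 2 ^ N" using True by (metis card.empty le_trans zero_le)
      also have "\<dots> \<le> (2 * K + 2 ^ N) * 1" by simp
      also have "\<dots> \<le> (2 * K + 2 ^ N) * (m + 1) ^ n" by (intro mult_le_mono) auto
      finally show ?thesis .
    next
      case False
      then obtain Z where Z: "Z \<in> M" and m: "6 * a + 4 * b < m" by (auto simp: N_def)
      have MD: "X \<in> ?C" "X \<subseteq> {..<m}" "finite X" "2 * card X = m" if "X \<in> M" for X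
        using that doubledD(3) finite_member unfolding M_def by blast+
      define near where "near = {X \<in> M. card (Z - X) \<le> b}"
      define far where "far = {X \<in> M. b < card (Z - X)}"
      have "card near \<le> K * (m + 1) ^ n"
      proof (rule part)
        show "near \<subseteq> ?C" by (auto simp: near_def M_def)
        fix X Y assume XY: "X \<in> near" "Y \<in> near"
        \<comment> \<open>Both sets miss at most \<open>b\<close> points of \<open>Z\<close>, so
          they share more than \<open>a\<close> points.\<close>
        have "Z \<subseteq> (Z - X) \<union> (Z - Y) \<union> (X \<inter> Y)" by blast
        then have "card Z \<le> card ((Z - X) \<union> (Z - Y) \<union> (X \<inter> Y))"
          using XY MD[OF Z] MD[of X] by (intro card_mono) (auto simp: near_def)
        also have "\<dots> \<le> card (Z - X) + card (Z - Y) + card (X \<inter> Y)"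
          by (meson add_mono_thms_linordered_semiring(3) card_Un_le le_trans)
        finally show "card (X \<inter> Y) \<noteq> a" using XY m MD(4)[OF Z] unfolding near_def by auto
      qed
      moreover have "card far \<le> K * (m + 1) ^ n"
      proof (rule part)
        show "far \<subseteq> ?C" by (auto simp: far_def M_def)
        \<comment> \<open>In the middle layer \<open>X - Z\<close> and \<open>Z - X\<close> have
          equal size, and so do the intersection and the outside. A far set with more than
          \<open>a\<close> points in \<open>Z\<close> would thus realise the pattern excluded by
          \<open>av2\<close>.\<close>
        have small: "card (Z \<inter> X) \<le> a" if "X \<in> far" for X
        proof (rule ccontr)
          assume h: "\<not> card (Z \<inter> X) \<le> a"
          have X: "X \<in> M" "b < card (Z - X)" using that by (auto simp: far_def)
          have "card (X - Z) = card (Z - X)"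
            using card_Diff_balance[of X Z] MD[OF X(1)] MD[OF Z] by simp
          moreover have "card ({..<m} - (Z \<union> X)) = card (Z \<inter> X)"
            using card_complement_Un[OF MD(2)[OF Z] MD(2)[OF X(1)]] MD(4)[OF X(1)] MD(4)[OF Z] by linarith
          ultimately show False
            using avoidsD[OF av2 MD(1)[OF Z] MD(1)[OF X(1)]] h X by simp
        qed
        fix X Y assume XY: "X \<in> far" "Y \<in> far"
        then have M: "X \<in> M" "Y \<in> M" by (auto simp: far_def)
        \<comment> \<open>A far set is nearly the complement of \<open>Z\<close>: at most
          \<open>a\<close> of its points lie in \<open>Z\<close>, and at most \<open>a\<close>
          further points are missed by \<open>Y\<close>.\<close>
        have "X \<subseteq> (Z \<inter> X) \<union> (({..<m} - (Z \<union> Y)) \<union> (X \<inter> Y))" using MD(2)[OF M(1)] by blast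
        then have "card X \<le> card ((Z \<inter> X) \<union> (({..<m} - (Z \<union> Y)) \<union> (X \<inter> Y)))"
          using MD[OF Z] MD[OF M(1)] by (intro card_mono) auto
        also have "\<dots> \<le> card (Z \<inter> X) + (card ({..<m} - (Z \<union> Y)) + card (X \<inter> Y))"
          by (meson add_left_mono card_Un_le le_trans)
        also have "card ({..<m} - (Z \<union> Y)) = card (Z \<inter> Y)"
          using card_complement_Un[OF MD(2)[OF Z] MD(2)[OF M(2)]] MD(4)[OF M(2)] MD(4)[OF Z] by linarith
        finally show "card (X \<inter> Y) \<noteq> a"
          using small[OF XY(1)] small[OF XY(2)] m MD(4)[OF M(1)] by auto
      qed
      moreover have "M = near \<union> far" by (auto simp: near_def far_def)
      then have "card M \<le> card near + card far" by (simp add: card_Un_le)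
      ultimately have "card M \<le> 2 * K * (m + 1) ^ n" by linarith
      then show ?thesis by (simp add: add_mult_distrib)
    qed
    have "?C = L \<union> (U \<union> M)" by (auto simp: L_def U_def M_def)
    then have "card ?C \<le> card L + (card U + card M)"
      by (metis add_left_mono card_Un_le le_trans)
    also have "\<dots> \<le> K * (m + 1) ^ n + (K * (m + 1) ^ n + (2 * K + 2 ^ N) * (m + 1) ^ n)"
      using L U M by (intro add_mono)
    also have "\<dots> = (4 * K + 2 ^ N) * (m + 1) ^ n" by (simp only: algebra_simps)
    finally show "card ?C \<le> (4 * K + 2 ^ N) * (m + 1) ^ n" .
  qed
qed

text \<open>The induction starts at one row [1 1]. With none, the exponent would be
  \<open>k\<close>, which fails for \<open>k = 0\<close>: a chain of \<open>m + 1\<close> sets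
  avoids \<open>0, 1, 1, 0\<close>.\<close>

lemma poly_bounded_symmetric: "poly_bounded (Suc a) (Suc k) (Suc k) (Suc a) (Suc a + k)"
proof (induction a)
  case 0
  then show ?case using poly_bounded_both[of k] by simp
next
  case (Suc a)
  then show ?case using poly_bounded_Suc_both by simp
qed

text \<open>The hypotheses force \<open>b\<close> to be positive. For \<open>a = 0\<close> the
  pattern lies below \<open>0, b, b - 1, 0\<close>, and for positive \<open>a\<close> below
  \<open>a, b, b, a\<close>.\<close>

theorem poly_bounded_pairs:
  assumes "d \<le> a" "c \<le> b" "c < b \<or> (1 \<le> a \<and> 1 \<le> b)"
  shows "poly_bounded a b c d (a + b - 1)"
proof (cases a)
  case 0
  then obtain k where "b = Suc k" using assms by (cases b) auto
  then show ?thesis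
    using assms 0 poly_bounded_mono[OF poly_bounded_differences[of k]] by simp
next
  case (Suc a')
  then obtain k where "b = Suc k" using assms by (cases b) auto
  then show ?thesis
    using assms Suc poly_bounded_mono[OF poly_bounded_symmetric[of a' k]] by simp
qed

section \<open>From repeated columns to heavy prefixes\<close>

text \<open>Each member of \<open>\<F>\<close> is charged to its longest prefix \<open>A \<inter> {..<k}\<close> that still has
  \<open>t\<close> extensions in \<open>\<F>\<close>; such a prefix is charged fewer than \<open>2 t\<close> times.\<close>

lemma card_le_sum_heavy_prefixes:
  assumes F: "\<F> \<subseteq> Pow {..<m::nat}" and t: "2 \<le> t"
  shows "card \<F> \<le> t + 2 * t * (\<Sum>k<m. card {X. X \<subseteq> {..<k} \<and> t \<le> card {A \<in> \<F>. A \<inter> {..<k} = X}})"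
\<comment> \<open>The summand \<open>t\<close> covers small families; in a larger one the empty
  prefix is heavy.\<close>
proof (cases "card \<F> \<le> t")
  case False
  define n where "n k X = card {A \<in> \<F>. A \<inter> {..<k} = X}" for k X
  define H where "H k = {X. X \<subseteq> {..<k} \<and> t \<le> n k X}" for k
  \<comment> \<open>A light prefix \<open>Y\<close> of length \<open>k + 1\<close> collects its
    fewer than \<open>t\<close> extensions. A heavy \<open>X\<close> pays for its two one-step
    continuations, which explains the factor \<open>2 * t\<close>.\<close>
  define E where "E k Y = (if n (Suc k) Y < t then {A \<in> \<F>. A \<inter> {..<Suc k} = Y} else {})" for k Y
  have fin: "finite \<F>" using F by (rule finite_family)
  have finH: "finite (H k)" for k by (rule finite_family[of _ k]) (auto simp: H_def)
  have E: "card (E k Y) \<le> t" for k Y by (auto simp: E_def n_def)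
  have cover: "\<exists>k<m. \<exists>X\<in>H k. A \<in> E k X \<union> E k (insert k X)" if A: "A \<in> \<F>" for A
  proof -
    \<comment> \<open>A prefix of full length has one extension and is light because
      \<open>t\<close> is at least 2. Between length 0 and length \<open>m\<close> there is thus a
      step from heavy to light.\<close>
    have "{B \<in> \<F>. B \<inter> {..<m} = A \<inter> {..<m}} = {A}"
      using F A by (auto simp: Int_absorb2 subset_iff Pow_def)
    then have m1: "n m (A \<inter> {..<m}) < t" using t by (simp add: n_def)
    have m0: "\<not> n 0 (A \<inter> {..<0}) < t" using False by (simp add: n_def)
    obtain k where k: "k < m" "\<not> n k (A \<inter> {..<k}) < t" "n (Suc k) (A \<inter> {..<Suc k}) < t"
      using ex_least_nat_less[of "\<lambda>k. n k (A \<inter> {..<k}) < t" m] m0 m1 by auto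
    have "A \<in> E k (A \<inter> {..<Suc k})" using k(3) A by (simp add: E_def)
    moreover have "A \<inter> {..<Suc k} = A \<inter> {..<k} \<or> A \<inter> {..<Suc k} = insert k (A \<inter> {..<k})"
      by (auto simp: lessThan_Suc)
    ultimately have "A \<in> E k (A \<inter> {..<k}) \<union> E k (insert k (A \<inter> {..<k}))" by (metis UnCI)
    moreover have "A \<inter> {..<k} \<in> H k" using k(2) by (auto simp: H_def)
    ultimately show ?thesis using k(1) by blast
  qed
  have finE: "finite (E k Y)" for k Y using fin by (simp add: E_def)
  have "\<F> \<subseteq> (\<Union>k\<in>{..<m}. \<Union>X\<in>H k. E k X \<union> E k (insert k X))" using cover by blast
  then have "card \<F> \<le> card (\<Union>k\<in>{..<m}. \<Union>X\<in>H k. E k X \<union> E k (insert k X))"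
    using finH finE by (intro card_mono) auto
  also have "\<dots> \<le> (\<Sum>k<m. card (\<Union>X\<in>H k. E k X \<union> E k (insert k X)))"
    by (rule card_UN_le) simp
  also have "\<dots> \<le> (\<Sum>k<m. \<Sum>X\<in>H k. card (E k X \<union> E k (insert k X)))"
    by (intro sum_mono card_UN_le finH)
  also have "\<dots> \<le> (\<Sum>k<m. \<Sum>X\<in>H k. 2 * t)"
  proof (intro sum_mono)
    fix k X
    show "card (E k X \<union> E k (insert k X)) \<le> 2 * t"
      using card_Un_le[of "E k X" "E k (insert k X)"] E[of k X] E[of k "insert k X"] by linarith
  qed
  also have "\<dots> = 2 * t * (\<Sum>k<m. card (H k))"
    by (simp add: sum_distrib_left mult.commute)
  finally show ?thesis by (simp add: H_def n_def)
qed simp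

section \<open>Configurations as injective row and column maps\<close>

lemma bij_betw_pick:
  assumes "finite S"
  shows "bij_betw (pick S) {..<card S} S"
proof -
  have "inj_on (pick S) {..<card S}"
    by (metis inj_onI lessThan_iff linorder_neqE_nat order_less_irrefl pick_mono_le)
  moreover have "pick S ` {..<card S} \<subseteq> S"
    by (auto intro: pick_in_set_le)
  ultimately show ?thesis
    using assms by (simp add: bij_betw_def card_image card_subset_eq)
qed

text \<open>A submatrix lists its rows and columns in increasing order, so an arbitrary injection
  has to be sorted by a permutation first.\<close>

lemma obtain_sorting_permutation:
  assumes "inj_on \<rho> {..<r::nat}"
  obtains p where "p permutes {..<r}" "\<And>i. i < r \<Longrightarrow> \<rho> (p i) = pick (\<rho> ` {..<r}) i"
proof -
  define I where "I = \<rho> ` {..<r}"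
  have I: "bij_betw \<rho> {..<r} I" using assms by (simp add: I_def bij_betw_def)
  have cI: "card I = r" using assms by (simp add: I_def card_image)
  have pI: "bij_betw (pick I) {..<r} I"
    using bij_betw_pick[of I] cI by (simp add: I_def)
  define p where "p i = (if i < r then inv_into {..<r} \<rho> (pick I i) else i)" for i
  have "bij_betw (inv_into {..<r} \<rho> \<circ> pick I) {..<r} {..<r}"
    by (rule bij_betw_trans[OF pI bij_betw_inv_into[OF I]])
  then have "bij_betw p {..<r} {..<r}"
    by (rule bij_betw_cong[THEN iffD1, rotated]) (simp add: p_def)
  then have "p permutes {..<r}" by (rule bij_imp_permutes) (simp add: p_def)
  moreover have "\<rho> (p i) = pick (\<rho> ` {..<r}) i" if "i < r" for i
    using that bij_betwE[OF pI] unfolding p_def I_def by (simp add: f_inv_into_f)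
  ultimately show thesis by (rule that)
qed

text \<open>The converse passage: undoing the permutation turns the increasing enumeration into an
  injection. \<open>I\<close> may contain indices from \<open>n\<close> on, hence the restriction to
  those below \<open>n\<close>.\<close>

lemma obtain_pick_embedding:
  assumes p: "p permutes {..<r}" and r: "card {i. i < n \<and> i \<in> I} = r"
  obtains \<rho> where "inj_on \<rho> {..<r}" "\<rho> ` {..<r} \<subseteq> {..<n::nat}"
    "\<And>i. i < r \<Longrightarrow> \<rho> (p i) = pick I i"
proof -
  let ?I = "{i. i < n \<and> i \<in> I}"
  have b: "bij_betw (pick ?I) {..<r} ?I" using bij_betw_pick[of ?I] r by simp
  have "bij_betw (pick ?I \<circ> inv_into UNIV p) {..<r} ?I"
    by (rule bij_betw_trans[OF permutes_imp_bij[OF permutes_inv[OF p]] b])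
  then have "inj_on (pick ?I \<circ> inv_into UNIV p) {..<r}" "(pick ?I \<circ> inv_into UNIV p) ` {..<r} \<subseteq> {..<n}"
    by (auto simp: bij_betw_def)
  moreover have "(pick ?I \<circ> inv_into UNIV p) (p i) = pick I i" if "i < r" for i
    using that r pick_reduce_set[of i n I] permutes_inverses(2)[OF p] by simp
  ultimately show thesis by (rule that)
qed

lemma config_iff_embedding:
  "F \<prec> A \<longleftrightarrow> (\<exists>\<rho> \<sigma>. inj_on \<rho> {..<dim_row F} \<and> \<rho> ` {..<dim_row F} \<subseteq> {..<dim_row A} \<and>
     inj_on \<sigma> {..<dim_col F} \<and> \<sigma> ` {..<dim_col F} \<subseteq> {..<dim_col A} \<and>
     (\<forall>i<dim_row F. \<forall>j<dim_col F. A $$ (\<rho> i, \<sigma> j) = F $$ (i, j)))" (is "_ \<longleftrightarrow> ?R")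
proof
  let ?r = "dim_row F" and ?s = "dim_col F"
  assume "F \<prec> A"
  then obtain p q I J where p: "p permutes {..<?r}" and q: "q permutes {..<?s}"
    and eq: "submatrix A I J = mat ?r ?s (\<lambda>(i, j). F $$ (p i, q j))"
    unfolding config_def by blast
  have r: "card {i. i < dim_row A \<and> i \<in> I} = ?r" and s: "card {j. j < dim_col A \<and> j \<in> J} = ?s"
    using arg_cong[OF eq, of dim_row] arg_cong[OF eq, of dim_col] by (simp_all add: dim_submatrix)
  obtain \<rho> where \<rho>: "inj_on \<rho> {..<?r}" "\<rho> ` {..<?r} \<subseteq> {..<dim_row A}"
    "\<And>i. i < ?r \<Longrightarrow> \<rho> (p i) = pick I i" using obtain_pick_embedding[OF p r] by blast
  obtain \<sigma> where \<sigma>: "inj_on \<sigma> {..<?s}" "\<sigma> ` {..<?s} \<subseteq> {..<dim_col A}"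
    "\<And>i. i < ?s \<Longrightarrow> \<sigma> (q i) = pick J i" using obtain_pick_embedding[OF q s] by blast
  have "A $$ (\<rho> i, \<sigma> j) = F $$ (i, j)" if ij: "i < ?r" "j < ?s" for i j
  proof -
    obtain i' j' where i': "i' < ?r" "p i' = i" and j': "j' < ?s" "q j' = j"
      using ij permutes_image[OF p] permutes_image[OF q] by (metis imageE lessThan_iff)
    have "A $$ (\<rho> i, \<sigma> j) = submatrix A I J $$ (i', j')"
      using \<rho>(3)[OF i'(1)] \<sigma>(3)[OF j'(1)] i' j' r s by (simp add: submatrix_index)
    then show ?thesis using eq i' j' by simp
  qed
  then show ?R using \<rho>(1,2) \<sigma>(1,2) by blast
next
  let ?r = "dim_row F" and ?s = "dim_col F"
  assume ?R
  then obtain \<rho> \<sigma> where \<rho>: "inj_on \<rho> {..<?r}" "\<rho> ` {..<?r} \<subseteq> {..<dim_row A}"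
    and \<sigma>: "inj_on \<sigma> {..<?s}" "\<sigma> ` {..<?s} \<subseteq> {..<dim_col A}"
    and eq: "\<And>i j. i < ?r \<Longrightarrow> j < ?s \<Longrightarrow> A $$ (\<rho> i, \<sigma> j) = F $$ (i, j)"
    by (elim exE conjE) (rule that, assumption+, blast)
  obtain p where p: "p permutes {..<?r}" "\<And>i. i < ?r \<Longrightarrow> \<rho> (p i) = pick (\<rho> ` {..<?r}) i"
    using obtain_sorting_permutation[OF \<rho>(1)] by blast
  obtain q where q: "q permutes {..<?s}" "\<And>i. i < ?s \<Longrightarrow> \<sigma> (q i) = pick (\<sigma> ` {..<?s}) i"
    using obtain_sorting_permutation[OF \<sigma>(1)] by blast
  have "{i. i < dim_row A \<and> i \<in> \<rho> ` {..<?r}} = \<rho> ` {..<?r}"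
    "{i. i < dim_col A \<and> i \<in> \<sigma> ` {..<?s}} = \<sigma> ` {..<?s}" using \<rho>(2) \<sigma>(2) by auto
  then have dims: "card {i. i < dim_row A \<and> i \<in> \<rho> ` {..<?r}} = ?r"
    "card {i. i < dim_col A \<and> i \<in> \<sigma> ` {..<?s}} = ?s"
    using card_image[OF \<rho>(1)] card_image[OF \<sigma>(1)] by simp_all
  have "submatrix A (\<rho> ` {..<?r}) (\<sigma> ` {..<?s}) = mat ?r ?s (\<lambda>(i, j). F $$ (p i, q j))"
  proof (rule eq_matI)
    fix i j assume "i < dim_row (mat ?r ?s (\<lambda>(i, j). F $$ (p i, q j)))"
      "j < dim_col (mat ?r ?s (\<lambda>(i, j). F $$ (p i, q j)))"
    then have ij: "i < ?r" "j < ?s" by simp_all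
    then have "p i < ?r" "q j < ?s"
      using permutes_in_image[OF p(1)] permutes_in_image[OF q(1)] by simp_all
    then have "A $$ (pick (\<rho> ` {..<?r}) i, pick (\<sigma> ` {..<?s}) j) = F $$ (p i, q j)"
      using p(2)[OF ij(1)] q(2)[OF ij(2)] eq by metis
    then show "submatrix A (\<rho> ` {..<?r}) (\<sigma> ` {..<?s}) $$ (i, j) =
        mat ?r ?s (\<lambda>(i, j). F $$ (p i, q j)) $$ (i, j)"
      using ij dims by (simp add: submatrix_index)
  qed (simp_all add: dim_submatrix dims)
  then show "F \<prec> A" unfolding config_def using p(1) q(1) by blast
qed

section \<open>Entries of the forbidden matrix, and columns as sets\<close>

lemma nth_concat_replicate:
  "j < t * length xs \<Longrightarrow> concat (replicate t xs) ! j = xs ! (j mod length xs)"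
proof (induction t arbitrary: j)
  case (Suc t)
  then show ?case
    by (cases "j < length xs") (auto simp: nth_append le_mod_geq)
qed simp

lemma length_concat_replicate: "length (concat (replicate t xs)) = t * length xs"
  by (induction t) auto

lemma dim_two_col_mat:
  "dim_row (two_col_mat e f g h) = e + f + g + h" "dim_col (two_col_mat e f g h) = 2"
  by (simp_all add: two_col_mat_def mat_of_rows_list_def)

lemma two_col_mat_index:
  assumes "i < e + f + g + h" "j < 2"
  shows "two_col_mat e f g h $$ (i, j) =
    (if j = 0 then if i < e + f then 1 else 0
     else if i < e \<or> e + f \<le> i \<and> i < e + f + g then 1 else 0)"
proof -
  have "j = 0 \<or> j = 1" using assms(2) by auto
  then show ?thesis
    using assms(1) by (auto simp: two_col_mat_def mat_of_rows_list_def nth_append)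
qed

lemma dim_copies: "dim_row (copies t M) = dim_row M" "dim_col (copies t M) = t * dim_col M"
  by (simp_all add: copies_def length_concat_replicate)

lemma copies_index:
  assumes "i < dim_row M" "j < t * dim_col M"
  shows "copies t M $$ (i, j) = M $$ (i, j mod dim_col M)"
proof -
  have "j mod dim_col M < dim_col M"
    using assms(2) by (metis gr_zeroI mod_less_divisor mult_0_right not_less_zero)
  then show ?thesis
    using assms by (simp add: copies_def mat_of_cols_index length_concat_replicate nth_concat_replicate)
qed

definition col_set :: "nat mat \<Rightarrow> nat \<Rightarrow> nat set" where
  "col_set A j = {i. i < dim_row A \<and> A $$ (i, j) = 1}"

text \<open>A (0,1)-column is determined by the positions of its ones, and the columns of a simple
  matrix are distinct.\<close>

lemma inj_on_col_set:
  assumes "simple_mat A"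
  shows "inj_on (col_set A) {..<dim_col A}"
proof (rule inj_onI)
  fix j k assume j: "j \<in> {..<dim_col A}" and k: "k \<in> {..<dim_col A}" and eq: "col_set A j = col_set A k"
  have zo: "A $$ (i, l) = 0 \<or> A $$ (i, l) = 1" if "i < dim_row A" "l < dim_col A" for i l
    using assms that elements_matI[of A "dim_row A" "dim_col A" i l]
    by (auto simp: simple_mat_def zero_one_mat_def)
  have "A $$ (i, j) = A $$ (i, k)" if "i < dim_row A" for i
  proof -
    have "A $$ (i, j) = 1 \<longleftrightarrow> A $$ (i, k) = 1"
      using eq that unfolding col_set_def by blast
    then show ?thesis using zo[OF that] j k by (metis lessThan_iff)
  qed
  then have "col A j = col A k" using j k by (auto simp: col_def)
  then have "cols A ! j = cols A ! k" using j k by simp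
  then show "j = k"
    using assms j k nth_eq_iff_index_eq[of "cols A" j k] by (simp add: simple_mat_def)
qed

lemma simple_mat_dim_col_le:
  assumes "simple_mat A"
  shows "dim_col A \<le> 2 ^ dim_row A"
proof -
  have "col_set A ` {..<dim_col A} \<subseteq> Pow {..<dim_row A}" by (auto simp: col_set_def)
  then have "card (col_set A ` {..<dim_col A}) \<le> 2 ^ dim_row A" by (rule card_subset_Pow)
  then show ?thesis by (simp add: card_image[OF inj_on_col_set[OF assms]])
qed

section \<open>Two heavy prefixes force the configuration\<close>

text \<open>This chooses the rows of an embedding in the block order of \<open>two_col_mat\<close>,
  by concatenating duplicate-free lists from the four regions.\<close>

lemma obtain_four_block_embedding:
  assumes "finite P" "finite Q" "finite R" "finite S"
    and "P \<inter> Q = {}" "P \<inter> R = {}" "P \<inter> S = {}" "Q \<inter> R = {}" "Q \<inter> S = {}" "R \<inter> S = {}"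
    and "a \<le> card P" "b \<le> card Q" "c \<le> card R" "d \<le> card S"
  obtains \<rho> where "inj_on \<rho> {..<a + b + c + d::nat}" "\<And>i. i < a \<Longrightarrow> \<rho> i \<in> P"
    "\<And>i. a \<le> i \<Longrightarrow> i < a + b \<Longrightarrow> \<rho> i \<in> Q" "\<And>i. a + b \<le> i \<Longrightarrow> i < a + b + c \<Longrightarrow> \<rho> i \<in> R"
    "\<And>i. a + b + c \<le> i \<Longrightarrow> i < a + b + c + d \<Longrightarrow> \<rho> i \<in> S"
proof -
  have ex: "\<exists>xs. distinct xs \<and> length xs = n \<and> set xs \<subseteq> T" if T: "finite T" "n \<le> card T" for n and T :: "'a set"
  proof -
    obtain T' where "T' \<subseteq> T" "card T' = n" using T obtain_subset_with_card_n by metis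
    moreover obtain xs where "set xs = T'" "distinct xs"
      using finite_distinct_list finite_subset[OF \<open>T' \<subseteq> T\<close> T(1)] by blast
    ultimately show ?thesis using distinct_card[of xs] by auto
  qed
  obtain ps where p: "distinct ps" "length ps = a" "set ps \<subseteq> P" using ex[OF assms(1,11)] by auto
  obtain qs where q: "distinct qs" "length qs = b" "set qs \<subseteq> Q" using ex[OF assms(2,12)] by auto
  obtain rs where r: "distinct rs" "length rs = c" "set rs \<subseteq> R" using ex[OF assms(3,13)] by auto
  obtain ss where s: "distinct ss" "length ss = d" "set ss \<subseteq> S" using ex[OF assms(4,14)] by auto
  let ?xs = "ps @ qs @ rs @ ss"
  have "distinct ?xs" using p q r s assms(5-10) by auto
  then have "inj_on (nth ?xs) {..<a + b + c + d}"
    using p q r s by (intro inj_on_nth) auto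
  moreover have "?xs ! i \<in> P" if "i < a" for i
    using that p by (auto simp: nth_append)
  moreover have "?xs ! i \<in> Q" if "a \<le> i" "i < a + b" for i
    using that p q nth_mem[of "i - a" qs] by (auto simp: nth_append)
  moreover have "?xs ! i \<in> R" if "a + b \<le> i" "i < a + b + c" for i
    using that p q r nth_mem[of "i - a - b" rs] by (auto simp: nth_append)
  moreover have "?xs ! i \<in> S" if "a + b + c \<le> i" "i < a + b + c + d" for i
    using that p q r s nth_mem[of "i - a - b - c" ss] by (auto simp: nth_append)
  ultimately show thesis by (rule that)
qed

text \<open>On the first \<open>k\<close> rows, the \<open>t\<close> columns extending
  \<open>X\<close> all look like \<open>X\<close>, and the \<open>t\<close> columns extending
  \<open>Y\<close> like \<open>Y\<close>. Rows chosen there for one copy of the pattern serve all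
  \<open>t\<close> copies.\<close>

lemma config_copies_if_heavy:
  assumes simple: "simple_mat A" and k: "k \<le> dim_row A"
    and X: "X \<subseteq> {..<k}" "t \<le> card {Z \<in> col_set A ` {..<dim_col A}. Z \<inter> {..<k} = X}"
    and Y: "Y \<subseteq> {..<k}" "t \<le> card {Z \<in> col_set A ` {..<dim_col A}. Z \<inter> {..<k} = Y}"
    and neq: "X \<noteq> Y"
    and cards: "a \<le> card (X \<inter> Y)" "b \<le> card (X - Y)" "c \<le> card (Y - X)" "d \<le> card ({..<k} - (X \<union> Y))"
  shows "copies t (two_col_mat a b c d) \<prec> A"
proof -
  have fin: "finite X" "finite Y" using X Y finite_member by blast+
  obtain \<rho> where \<rho>: "inj_on \<rho> {..<a + b + c + d}" "\<And>i. i < a \<Longrightarrow> \<rho> i \<in> X \<inter> Y"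
    "\<And>i. a \<le> i \<Longrightarrow> i < a + b \<Longrightarrow> \<rho> i \<in> X - Y" "\<And>i. a + b \<le> i \<Longrightarrow> i < a + b + c \<Longrightarrow> \<rho> i \<in> Y - X"
    "\<And>i. a + b + c \<le> i \<Longrightarrow> i < a + b + c + d \<Longrightarrow> \<rho> i \<in> {..<k} - (X \<union> Y)"
    using fin cards
    by (rule_tac obtain_four_block_embedding[of "X \<inter> Y" "X - Y" "Y - X" "{..<k} - (X \<union> Y)" a b c d]) auto
  have \<rho>k: "\<rho> i < k" and \<rho>X: "\<rho> i \<in> X \<longleftrightarrow> i < a + b"
    and \<rho>Y: "\<rho> i \<in> Y \<longleftrightarrow> i < a \<or> a + b \<le> i \<and> i < a + b + c" if "i < a + b + c + d" for i
    using that \<rho>(2-5)[of i] X(1) Y(1) by (cases "i < a"; cases "i < a + b"; cases "i < a + b + c"; force)+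
  have ex: "\<exists>g. g ` {..<t} \<subseteq> {j. j < dim_col A \<and> col_set A j \<inter> {..<k} = W} \<and> inj_on g {..<t}"
    if "t \<le> card {Z \<in> col_set A ` {..<dim_col A}. Z \<inter> {..<k} = W}" for W
  proof (rule card_le_inj)
    have "{Z \<in> col_set A ` {..<dim_col A}. Z \<inter> {..<k} = W} =
        col_set A ` {j. j < dim_col A \<and> col_set A j \<inter> {..<k} = W}" by auto
    then show "card {..<t} \<le> card {j. j < dim_col A \<and> col_set A j \<inter> {..<k} = W}"
      using that card_image_le[of "{j. j < dim_col A \<and> col_set A j \<inter> {..<k} = W}" "col_set A"] by simp
  qed simp_all
  obtain g where g: "g ` {..<t} \<subseteq> {j. j < dim_col A \<and> col_set A j \<inter> {..<k} = X}" "inj_on g {..<t}"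
    using ex[OF X(2)] by blast
  obtain h where h: "h ` {..<t} \<subseteq> {j. j < dim_col A \<and> col_set A j \<inter> {..<k} = Y}" "inj_on h {..<t}"
    using ex[OF Y(2)] by blast
  \<comment> \<open>The columns of the copies alternate between the two types, so parity selects the
    type and \<open>j div 2\<close> the copy.\<close>
  define \<sigma> where "\<sigma> j = (if even j then g (j div 2) else h (j div 2))" for j
  have \<sigma>n: "\<sigma> j < dim_col A" and \<sigma>s: "col_set A (\<sigma> j) \<inter> {..<k} = (if even j then X else Y)"
    if "j < t * 2" for j
  proof -
    have "j div 2 \<in> {..<t}" using that by auto
    then have "g (j div 2) \<in> {j. j < dim_col A \<and> col_set A j \<inter> {..<k} = X}"
      "h (j div 2) \<in> {j. j < dim_col A \<and> col_set A j \<inter> {..<k} = Y}" using g h by blast+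
    then show "\<sigma> j < dim_col A" "col_set A (\<sigma> j) \<inter> {..<k} = (if even j then X else Y)"
      by (simp_all add: \<sigma>_def)
  qed
  have inj: "inj_on \<sigma> {..<t * 2}"
  proof (rule inj_onI)
    fix i j assume i: "i \<in> {..<t * 2}" and j: "j \<in> {..<t * 2}" and eq: "\<sigma> i = \<sigma> j"
    \<comment> \<open>Since \<open>X\<close> and \<open>Y\<close> differ, the trace of a column on
      the first \<open>k\<close> rows reveals its parity.\<close>
    have par: "even i = even j" using \<sigma>s[of i] \<sigma>s[of j] i j eq neq by (auto split: if_splits)
    moreover have "i div 2 \<in> {..<t}" "j div 2 \<in> {..<t}" using i j by auto
    ultimately have "i div 2 = j div 2"
      using eq g(2) h(2) unfolding \<sigma>_def by (auto dest: inj_onD split: if_splits)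
    then show "i = j" using par by (metis div_mult_mod_eq even_iff_mod_2_eq_zero not_mod_2_eq_1_eq_0)
  qed
  have entry: "A $$ (\<rho> i, \<sigma> j) = copies t (two_col_mat a b c d) $$ (i, j)"
    if ij: "i < a + b + c + d" "j < t * 2" for i j
  proof -
    have i: "\<rho> i < dim_row A" using \<rho>k[OF ij(1)] k by simp
    have "A $$ (\<rho> i, \<sigma> j) \<in> elements_mat A"
      using elements_matI[of A "dim_row A" "dim_col A"] i \<sigma>n[OF ij(2)] by auto
    then have zo: "A $$ (\<rho> i, \<sigma> j) = 0 \<or> A $$ (\<rho> i, \<sigma> j) = 1"
      using simple by (auto simp: simple_mat_def zero_one_mat_def)
    have "A $$ (\<rho> i, \<sigma> j) = 1 \<longleftrightarrow> \<rho> i \<in> col_set A (\<sigma> j) \<inter> {..<k}"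
      using i \<rho>k[OF ij(1)] by (simp add: col_set_def)
    also have "\<dots> \<longleftrightarrow> \<rho> i \<in> (if even j then X else Y)" by (simp only: \<sigma>s[OF ij(2)])
    finally have one: "A $$ (\<rho> i, \<sigma> j) = 1 \<longleftrightarrow>
        (if even j then i < a + b else i < a \<or> a + b \<le> i \<and> i < a + b + c)"
      using \<rho>X[OF ij(1)] \<rho>Y[OF ij(1)] by simp
    have "copies t (two_col_mat a b c d) $$ (i, j) = two_col_mat a b c d $$ (i, j mod 2)"
      using ij by (simp add: copies_index dim_two_col_mat)
    also have "\<dots> = (if even j then if i < a + b then 1 else 0
        else if i < a \<or> a + b \<le> i \<and> i < a + b + c then 1 else 0)"
      using ij two_col_mat_index[of i a b c d "j mod 2"] by (simp add: even_iff_mod_2_eq_zero)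
    finally show ?thesis using zo one by (auto split: if_splits)
  qed
  have "\<rho> ` {..<a + b + c + d} \<subseteq> {..<dim_row A}" using \<rho>k k by fastforce
  moreover have "\<sigma> ` {..<t * 2} \<subseteq> {..<dim_col A}" using \<sigma>n by auto
  ultimately show ?thesis
    unfolding config_iff_embedding dim_copies dim_two_col_mat using \<rho>(1) inj entry by blast
qed

section \<open>The lower bound construction\<close>

text \<open>The columns are all sets of size \<open>a + b\<close>. A column of the first type has
  ones in \<open>a + b\<close> prescribed rows and is thereby determined, whereas two copies require
  two such columns.\<close>

lemma exists_simple_mat_avoiding_copies:
  assumes t: "2 \<le> t"
  shows "\<exists>A\<in>carrier_mat m (m choose (a + b)). simple_mat A \<and> \<not> copies t (two_col_mat a b c d) \<prec> A"
proof -
  have "finite {X. X \<subseteq> {..<m} \<and> card X = a + b}" by (rule finite_family[of _ m]) auto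
  then obtain Ls where Ls: "set Ls = {X. X \<subseteq> {..<m} \<and> card X = a + b}" "distinct Ls" using finite_distinct_list by blast
  then have len: "length Ls = m choose (a + b)"
    using distinct_card[of Ls] n_subsets[of "{..<m}" "a + b"] by simp
  define A where "A = mat m (length Ls) (\<lambda>(i, j). if i \<in> Ls ! j then 1 else 0 :: nat)"
  have dims: "dim_row A = m" "dim_col A = length Ls" by (simp_all add: A_def)
  have Lsj: "Ls ! j \<subseteq> {..<m}" "card (Ls ! j) = a + b" if "j < length Ls" for j
    using nth_mem[OF that] Ls(1) by auto
  have cols_set: "col_set A j = Ls ! j" if "j < length Ls" for j
    using that Lsj[OF that] by (auto simp: col_set_def A_def split: if_splits)
  have "zero_one_mat A" by (auto simp: zero_one_mat_def A_def dest!: elements_matD split: if_splits)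
  moreover have "distinct (cols A)"
  proof (rule distinct_conv_nth[THEN iffD2], intro allI impI)
    fix i j assume ij: "i < length (cols A)" "j < length (cols A)" "i \<noteq> j"
    then have l: "i < length Ls" "j < length Ls" by (simp_all add: dims)
    show "cols A ! i \<noteq> cols A ! j"
    proof
      assume "cols A ! i = cols A ! j"
      then have "col A i = col A j" using ij by simp
      then have "A $$ (r, i) = A $$ (r, j)" if "r < m" for r
        using that l by (metis dims index_col)
      then have "col_set A i = col_set A j" by (auto simp: col_set_def dims)
      then show False using l ij(3) Ls(2) cols_set by (simp add: nth_eq_iff_index_eq)
    qed
  qed
  ultimately have "simple_mat A" by (simp add: simple_mat_def)
  moreover have "\<not> copies t (two_col_mat a b c d) \<prec> A"
  proof
    assume "copies t (two_col_mat a b c d) \<prec> A"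
    then obtain \<rho> \<sigma> where \<rho>: "inj_on \<rho> {..<a + b + c + d}" "\<rho> ` {..<a + b + c + d} \<subseteq> {..<m}"
      and \<sigma>: "inj_on \<sigma> {..<t * 2}" "\<sigma> ` {..<t * 2} \<subseteq> {..<length Ls}"
      and eq: "\<And>i j. i < a + b + c + d \<Longrightarrow> j < t * 2 \<Longrightarrow>
        A $$ (\<rho> i, \<sigma> j) = copies t (two_col_mat a b c d) $$ (i, j)"
      unfolding config_iff_embedding dim_copies dim_two_col_mat dims
      by (elim exE conjE) (rule that, assumption+, blast)
    have inj: "inj_on \<rho> {..<a + b}" by (rule inj_on_subset[OF \<rho>(1)]) auto
    have full: "\<rho> ` {..<a + b} = Ls ! \<sigma> j" if j: "j < t * 2" "even j" for j
    proof (rule card_subset_eq)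
      have l: "\<sigma> j < length Ls" using \<sigma>(2) j by auto
      show "finite (Ls ! \<sigma> j)" using Lsj[OF l] finite_member by blast
      show "card (\<rho> ` {..<a + b}) = card (Ls ! \<sigma> j)" using card_image[OF inj] Lsj[OF l] by simp
      show "\<rho> ` {..<a + b} \<subseteq> Ls ! \<sigma> j"
      proof clarsimp
        fix i assume i: "i < a + b"
        have "A $$ (\<rho> i, \<sigma> j) = two_col_mat a b c d $$ (i, j mod 2)"
          using i j eq[of i j] by (simp add: copies_index dim_two_col_mat)
        also have "\<dots> = 1" using i j by (simp add: two_col_mat_index)
        finally have "A $$ (\<rho> i, \<sigma> j) = 1" .
        moreover have "\<rho> i < m" using subsetD[OF \<rho>(2) imageI[of i]] i by simp
        ultimately have "\<rho> i \<in> col_set A (\<sigma> j)" by (simp add: col_set_def dims)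
        then show "\<rho> i \<in> Ls ! \<sigma> j" using cols_set[OF l] by simp
      qed
    qed
    \<comment> \<open>Columns 0 and 2 are the first columns of the first two copies; both exist
      because \<open>t\<close> is at least 2.\<close>
    have "Ls ! \<sigma> 0 = Ls ! \<sigma> 2" using full[of 0] full[of 2] t by simp
    moreover have "\<sigma> 0 < length Ls" "\<sigma> 2 < length Ls"
      using subsetD[OF \<sigma>(2) imageI[of 0]] subsetD[OF \<sigma>(2) imageI[of 2]] t by simp_all
    ultimately have "\<sigma> 0 = \<sigma> 2" using Ls(2) by (simp add: nth_eq_iff_index_eq)
    then show False using inj_onD[OF \<sigma>(1), of 0 2] t by simp
  qed
  moreover have "A \<in> carrier_mat m (m choose (a + b))" using dims len by auto
  ultimately show ?thesis by blast
qed

section \<open>Bounds on \<open>forb\<close> and the asymptotics\<close>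

lemma finite_forb_set: "finite {n. \<exists>A\<in>carrier_mat m n. simple_mat A \<and> \<not> F \<prec> A}"
  by (rule finite_subset[of _ "{..2 ^ m}"]) (auto dest: simple_mat_dim_col_le)

lemma forb_copies_ge:
  assumes "2 \<le> t"
  shows "m choose (a + b) \<le> forb m (copies t (two_col_mat a b c d))"
  unfolding forb_def
  using exists_simple_mat_avoiding_copies[OF assms] by (intro Max_ge finite_forb_set) blast

text \<open>The bound for pairs applies to the heavy prefixes of each length below \<open>m\<close>;
  summing over these lengths contributes one more factor \<open>m\<close>.\<close>

lemma forb_copies_le:
  assumes t: "2 \<le> t" and b: "1 \<le> b"
    and K: "\<And>m \<F>. \<F> \<subseteq> Pow {..<m} \<Longrightarrow> avoids a b c d m \<F> \<Longrightarrow> card \<F> \<le> K * (m + 1) ^ (a + b - 1)"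
  shows "forb m (copies t (two_col_mat a b c d)) \<le> t + 2 * t * K * m ^ (a + b)"
proof -
  let ?F = "copies t (two_col_mat a b c d)"
  let ?S = "{n. \<exists>A\<in>carrier_mat m n. simple_mat A \<and> \<not> ?F \<prec> A}"
  \<comment> \<open>Together with finiteness, this ensures that the maximum is attained by a
    matrix.\<close>
  have "?S \<noteq> {}" using exists_simple_mat_avoiding_copies[OF t] by blast
  then have "forb m ?F \<in> ?S" unfolding forb_def using finite_forb_set by (intro Max_in)
  then obtain A where A: "A \<in> carrier_mat m (forb m ?F)" "simple_mat A" "\<not> ?F \<prec> A" by blast
  define \<F> where "\<F> = col_set A ` {..<dim_col A}"
  have F: "\<F> \<subseteq> Pow {..<m}" using A(1) by (auto simp: \<F>_def col_set_def)
  define H where "H k = {X. X \<subseteq> {..<k} \<and> t \<le> card {Z \<in> \<F>. Z \<inter> {..<k} = X}}" for k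
  have H: "card (H k) \<le> K * m ^ (a + b - 1)" if k: "k < m" for k
  proof -
    have "avoids a b c d k (H k)"
      unfolding avoids_def
    proof (intro ballI notI, elim conjE)
      fix X Y assume XY: "X \<in> H k" "Y \<in> H k"
        and c: "a \<le> card (X \<inter> Y)" "b \<le> card (X - Y)" "c \<le> card (Y - X)" "d \<le> card ({..<k} - (X \<union> Y))"
      \<comment> \<open>As \<open>b\<close> is positive, \<open>X - Y\<close> is nonempty.\<close>
      have "X \<noteq> Y" using c(2) b by auto
      moreover have "k \<le> dim_row A" using A(1) k by auto
      ultimately have "?F \<prec> A"
        using XY c by (intro config_copies_if_heavy[OF A(2)]) (auto simp: H_def \<F>_def)
      then show False using A(3) by simp
    qed
    then have "card (H k) \<le> K * (k + 1) ^ (a + b - 1)" by (intro K) (auto simp: H_def)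
    also have "\<dots> \<le> K * m ^ (a + b - 1)" using k by (intro mult_le_mono power_mono) auto
    finally show ?thesis .
  qed
  have "forb m ?F = card \<F>"
    using A(1) card_image[OF inj_on_col_set[OF A(2)]] by (simp add: \<F>_def)
  also have "\<dots> \<le> t + 2 * t * (\<Sum>k<m. card (H k))"
    unfolding H_def by (rule card_le_sum_heavy_prefixes[OF F t])
  also have "(\<Sum>k<m. card (H k)) \<le> (\<Sum>k<m. K * m ^ (a + b - 1))"
    by (rule sum_mono) (use H in auto)
  also have "\<dots> = K * m ^ (a + b)"
    using b by (simp add: power_eq_if[of m "a + b"])
  finally show ?thesis by (simp add: mult.assoc)
qed

theorem theorem3:
  fixes t a b c d :: nat
  assumes "t \<ge> 2" and "a \<ge> d" and "b \<ge> c"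
    and "b > c \<or> (a \<ge> 1 \<and> b \<ge> 1)"
  shows "(\<lambda>m. real (forb m (copies t (two_col_mat a b c d)))) \<in> \<Theta>(\<lambda>m. real m ^ (a + b))"
proof -
  let ?f = "\<lambda>m. forb m (copies t (two_col_mat a b c d))"
  have b: "1 \<le> b" using assms(4) by auto
  obtain K where K: "\<And>m \<F>. \<F> \<subseteq> Pow {..<m} \<Longrightarrow> avoids a b c d m \<F> \<Longrightarrow> card \<F> \<le> K * (m + 1) ^ (a + b - 1)"
    using poly_bounded_pairs[OF assms(2-4)] unfolding poly_bounded_def by blast
  have "(\<lambda>m. real (?f m)) \<in> O(\<lambda>m. real m ^ (a + b))"
  \<comment> \<open>For \<open>m\<close> at least 1 the additive \<open>t\<close> is absorbed into
    \<open>t * m ^ (a + b)\<close>.\<close>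
  proof (rule bigoI[where c = "real (t + 2 * t * K)"])
    show "\<forall>\<^sub>F m in sequentially. norm (real (?f m)) \<le> real (t + 2 * t * K) * norm (real m ^ (a + b))"
      using eventually_ge_at_top[of 1]
    proof eventually_elim
      case (elim m)
      have "?f m \<le> t * 1 + 2 * t * K * m ^ (a + b)" using forb_copies_le[OF assms(1) b K] by simp
      also have "\<dots> \<le> t * m ^ (a + b) + 2 * t * K * m ^ (a + b)"
        using elim by (intro add_mono mult_le_mono) auto
      finally have "?f m \<le> (t + 2 * t * K) * m ^ (a + b)" by (simp add: add_mult_distrib)
      then have "real (?f m) \<le> real ((t + 2 * t * K) * m ^ (a + b))" by (rule of_nat_mono)
      then show ?case by simp
    qed
  qed
  moreover have "(\<lambda>m. real m ^ (a + b)) \<in> O(\<lambda>m. real (?f m))"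
  \<comment> \<open>The constant comes from bounding \<open>m choose (a + b)\<close> below by
    \<open>(m / (a + b)) ^ (a + b)\<close>.\<close>
  proof (rule bigoI[where c = "real (a + b) ^ (a + b)"])
    show "\<forall>\<^sub>F m in sequentially. norm (real m ^ (a + b)) \<le> real (a + b) ^ (a + b) * norm (real (?f m))"
      using eventually_ge_at_top[of "a + b"]
    proof eventually_elim
      case (elim m)
      have "(real m / real (a + b)) ^ (a + b) \<le> real (m choose (a + b))"
        using elim by (rule binomial_ge_n_over_k_pow_k)
      also have "\<dots> \<le> real (?f m)" using forb_copies_ge[OF assms(1)] by (rule of_nat_mono)
      finally have "real m ^ (a + b) / real (a + b) ^ (a + b) \<le> real (?f m)" by (simp only: power_divide)
      moreover have "0 < real (a + b) ^ (a + b)" using b by simp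
      ultimately have "real m ^ (a + b) \<le> real (?f m) * real (a + b) ^ (a + b)"
        by (simp only: pos_divide_le_eq)
      then show ?case by (simp add: mult.commute)
    qed
  qed
  ultimately show ?thesis by (simp add: bigtheta_def bigomega_iff_bigo)
qed

end
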